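(* For every partial sign matrix $A\in\{-1,1,*\}^{M\times N}$, $$\operatorname{ind}_{\mathbb{Z}_2}(S(A))\le \operatorname{rank}^{\pm}(A)-1 .$$
   Context: The sign-rank $\operatorname{rank}^{\pm}(A)$ of a partial sign matrix $A\in\{-1,1,*\}^{M\times N}$ is the smallest integer $d$ for which there exist nonzero vectors $u_1,\dots,u_M\in\mathbb{R}^d$ and $v_1,\dots,v_N\in\mathbb{R}^d$ such that $\operatorname{sign}(\langle u_i,v_j\rangle)=A_{ij}$ for every $(i,j)$ with $A_{ij}\in\{-1,1\}$. Sign complex. For $A\in\{-1,1,*\}^{M\times N}$ and each row $r$ of $A$, let $\sigma_r^+=\{i^+: r_i=+1\}\cup\{i^-: r_i=-1\}$ and $\sigma_r^-=\{i^-: r_i=+1\}\cup\{i^+: r_i=-1\}$, subsets of $\{1^+,1^-,\dots,N^+,N^-\}$. The sign complex $S(A)$ is the abstract simplicial complex whose simplices are all subsets of $\sigma_r^+$ or $\sigma_r^-$ over all rows $r$. The involution $i^+\leftrightarrow i^-$ is a free simplicial $\mathbb{Z}_2$-action on $S(A)$. Its geometric realization is $|S(A)|=\bigcup_{\sigma\in S(A)}\operatorname{conv}\{\phi(v):v\in\sigma\}\subset\mathbb{R}^N$, where $\phi(i^+)=e_i$, $\phi(i^-)=-e_i$; the involution becomes $x\mapsto -x$. Index. For a free $\mathbb{Z}_2$-complex $K$, $\operatorname{ind}_{\mathbb{Z}_2}(K)$ is the minimum $d\ge 0$ for which there is a continuous $\mathbb{Z}_2$-equivariant map $|K|\to\mathbb{S}^d$,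 where the unit sphere $\mathbb{S}^d$ carries the antipodal action $x\mapsto -x$. *)

theory Defs
  imports "HOL-Analysis.Analysis"
begin

section \<open>Partial sign matrices and sign-rank\<close>

datatype pm = Pos | Neg

primrec pm_val :: "pm \<Rightarrow> real" where
  "pm_val Pos = 1"
| "pm_val Neg = -1"

text \<open>A partial sign matrix with rows \<open>'m\<close> and columns \<open>'n\<close>; the entry \<open>None\<close> stands for \<open>*\<close>.\<close>
type_synonym ('m, 'n) psign_matrix = "((pm option)^'n)^'m"

text \<open>The dimension \<open>d\<close> ranges over all naturals, so \<open>\<real>\<^sup>d\<close> is the library's
  \<^const>\<open>Euclidean_space\<close> \<open>d\<close>: the functions \<open>nat \<Rightarrow> real\<close> vanishing from index \<open>d\<close> on.\<close>

definition sign_realizable :: "('m::finite, 'n::finite) psign_matrix \<Rightarrow> nat \<Rightarrow> bool" where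
  "sign_realizable A d \<longleftrightarrow>
     (\<exists>(u :: 'm \<Rightarrow> nat \<Rightarrow> real) (v :: 'n \<Rightarrow> nat \<Rightarrow> real).
        (\<forall>i. u i \<in> topspace (Euclidean_space d) \<and> u i \<noteq> (\<lambda>_. 0)) \<and>
        (\<forall>j. v j \<in> topspace (Euclidean_space d) \<and> v j \<noteq> (\<lambda>_. 0)) \<and>
        (\<forall>i j s. A $ i $ j = Some s \<longrightarrow> sgn (\<Sum>k<d. u i k * v j k) = pm_val s))"

definition sign_rank :: "('m::finite, 'n::finite) psign_matrix \<Rightarrow> nat" where
  "sign_rank A = (LEAST d. sign_realizable A d)"


section \<open>The sign complex\<close>

text \<open>The vertices \<open>j\<^sup>+\<close> and \<open>j\<^sup>-\<close> are the pairs \<open>(j, Pos)\<close> and \<open>(j, Neg)\<close>.\<close>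

definition sigma_pos :: "(pm option)^'n::finite \<Rightarrow> ('n \<times> pm) set" where
  "sigma_pos r = {(j, Pos) | j. r $ j = Some Pos} \<union> {(j, Neg) | j. r $ j = Some Neg}"

definition sigma_neg :: "(pm option)^'n::finite \<Rightarrow> ('n \<times> pm) set" where
  "sigma_neg r = {(j, Neg) | j. r $ j = Some Pos} \<union> {(j, Pos) | j. r $ j = Some Neg}"

definition sign_complex :: "('m::finite, 'n::finite) psign_matrix \<Rightarrow> ('n \<times> pm) set set" where
  "sign_complex A = {\<tau>. \<exists>i. \<tau> \<subseteq> sigma_pos (A $ i) \<or> \<tau> \<subseteq> sigma_neg (A $ i)}"

definition vertex_point :: "'n \<times> pm \<Rightarrow> real^'n::finite" where
  "vertex_point w = pm_val (snd w) *\<^sub>R axis (fst w) 1"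

definition realization :: "('n \<times> pm) set set \<Rightarrow> (real^'n::finite) set" where
  "realization K = (\<Union>\<sigma>\<in>K. convex hull (vertex_point ` \<sigma>))"


section \<open>The index\<close>

definition equivariant_to_sphere ::
    "'a topology \<Rightarrow> ('a \<Rightarrow> 'a) \<Rightarrow> nat \<Rightarrow> ('a \<Rightarrow> nat \<Rightarrow> real) \<Rightarrow> bool" where
  "equivariant_to_sphere X \<nu> d f \<longleftrightarrow>
     continuous_map X (nsphere d) f \<and> (\<forall>x\<in>topspace X. f (\<nu> x) = (\<lambda>k. - f x k))"

definition Z2_index :: "'a topology \<Rightarrow> ('a \<Rightarrow> 'a) \<Rightarrow> nat" where
  "Z2_index X \<nu> = (LEAST d. \<exists>f. equivariant_to_sphere X \<nu> d f)"

text \<open>The index of a complex on the vertices \<open>j\<^sup>+\<close>, \<open>j\<^sup>-\<close>: the involution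
  swapping \<open>j\<^sup>+\<close> and \<open>j\<^sup>-\<close> is \<open>x \<mapsto> -x\<close> on the realization.\<close>
definition complex_index :: "('n::finite \<times> pm) set set \<Rightarrow> nat" where
  "complex_index K = Z2_index (top_of_set (realization K)) uminus"


section \<open>The involution on the sign complex, and existence of the two minima\<close>

primrec opp :: "pm \<Rightarrow> pm" where
  "opp Pos = Neg"
| "opp Neg = Pos"

definition flip :: "'n \<times> pm \<Rightarrow> 'n \<times> pm" where
  "flip w = (fst w, opp (snd w))"

lemma opp_opp [simp]: "opp (opp s) = s"
  by (cases s) auto

lemma flip_flip [simp]: "flip (flip w) = w"
  by (simp add: flip_def)

lemma vertex_point_flip: "vertex_point (flip w) = - vertex_point w"
  by (cases "snd w") (auto simp: vertex_point_def flip_def)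

lemma mem_sigma_pos: "(j, s) \<in> sigma_pos r \<longleftrightarrow> r $ j = Some s"
  by (cases s) (auto simp: sigma_pos_def)

lemma mem_sigma_neg: "(j, s) \<in> sigma_neg r \<longleftrightarrow> r $ j = Some (opp s)"
  by (cases s) (auto simp: sigma_neg_def)

lemma mem_flip_image: "(j, s) \<in> flip ` T \<longleftrightarrow> (j, opp s) \<in> T"
proof
  assume "(j, opp s) \<in> T"
  then have "flip (j, opp s) \<in> flip ` T"
    by (rule imageI)
  then show "(j, s) \<in> flip ` T"
    by (simp add: flip_def)
qed (auto simp: flip_def)

lemma flip_sigma_pos: "flip ` sigma_pos r = sigma_neg r"
  and flip_sigma_neg: "flip ` sigma_neg r = sigma_pos r"
  by (simp_all add: set_eq_iff split_paired_all mem_flip_image mem_sigma_pos mem_sigma_neg)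

lemma flip_sign_complex:
  assumes "\<tau> \<in> sign_complex A"
  shows "flip ` \<tau> \<in> sign_complex A"
proof -
  from assms obtain i where "\<tau> \<subseteq> sigma_pos (A $ i) \<or> \<tau> \<subseteq> sigma_neg (A $ i)"
    by (auto simp: sign_complex_def)
  then have "flip ` \<tau> \<subseteq> sigma_neg (A $ i) \<or> flip ` \<tau> \<subseteq> sigma_pos (A $ i)"
    by (metis image_mono flip_sigma_pos flip_sigma_neg)
  then show ?thesis
    by (auto simp: sign_complex_def)
qed

lemma realization_uminus:
  fixes A :: "('m::finite, 'n::finite) psign_matrix"
  assumes "x \<in> realization (sign_complex A)"
  shows "- x \<in> realization (sign_complex A)"
proof -
  from assms obtain \<tau> where \<tau>: "\<tau> \<in> sign_complex A" "x \<in> convex hull (vertex_point ` \<tau>)"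
    by (auto simp: realization_def)
  have "convex hull (vertex_point ` flip ` \<tau>) = uminus ` (convex hull (vertex_point ` \<tau>))"
    using convex_hull_linear_image [of "uminus :: real^'n \<Rightarrow> real^'n" "vertex_point ` \<tau>"]
    by (simp add: image_image vertex_point_flip linear_uminus)
  then have "- x \<in> convex hull (vertex_point ` flip ` \<tau>)"
    using \<tau>(2) by auto
  then show ?thesis
    using flip_sign_complex [OF \<tau>(1)] by (auto simp: realization_def)
qed

lemma zero_notin_realization: "0 \<notin> realization (sign_complex A)"
proof
  assume "0 \<in> realization (sign_complex A)"
  then obtain \<tau> where \<tau>: "\<tau> \<in> sign_complex A" "0 \<in> convex hull (vertex_point ` \<tau>)"
    by (auto simp: realization_def)
  define g where "g i = (\<chi> j. case A $ i $ j of None \<Rightarrow> 0 | Some s \<Rightarrow> pm_val s)" for i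
  have g: "g i \<bullet> vertex_point (j, s) = (case A $ i $ j of None \<Rightarrow> 0 | Some t \<Rightarrow> pm_val s * pm_val t)"
    for i j s
    by (auto simp: g_def vertex_point_def inner_axis split: option.splits)
  have "\<exists>a. \<forall>w\<in>\<tau>. a \<bullet> vertex_point w = 1"
  proof -
    from \<tau>(1) obtain i where "\<tau> \<subseteq> sigma_pos (A $ i) \<or> \<tau> \<subseteq> sigma_neg (A $ i)"
      by (auto simp: sign_complex_def)
    then show ?thesis
    proof
      assume sub: "\<tau> \<subseteq> sigma_pos (A $ i)"
      have "g i \<bullet> vertex_point (j, s) = 1" if "(j, s) \<in> \<tau>" for j s
        using subsetD [OF sub that] by (cases s) (auto simp: mem_sigma_pos g)
      then show ?thesis by (intro exI [of _ "g i"]) auto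
    next
      assume sub: "\<tau> \<subseteq> sigma_neg (A $ i)"
      have "(- g i) \<bullet> vertex_point (j, s) = 1" if "(j, s) \<in> \<tau>" for j s
        using subsetD [OF sub that] by (cases s) (auto simp: mem_sigma_neg g)
      then show ?thesis by (intro exI [of _ "- g i"]) auto
    qed
  qed
  then obtain a where a: "vertex_point ` \<tau> \<subseteq> {x. a \<bullet> x = 1}"
    by auto
  have "convex hull (vertex_point ` \<tau>) \<subseteq> {x. a \<bullet> x = 1}"
    by (rule hull_minimal [OF a]) (rule convex_hyperplane)
  with \<tau>(2) show False by auto
qed

lemma sign_realizable_exists:
  fixes A :: "('m::finite, 'n::finite) psign_matrix"
  shows "\<exists>d. sign_realizable A d"
proof -
  obtain e :: "'n \<Rightarrow> nat" where e: "bij_betw e UNIV {0..<CARD('n)}"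
    using ex_bij_betw_finite_nat [of "UNIV :: 'n set"] by auto
  define v where "v j = (\<lambda>k. if k = e j then 1 else (0::real))" for j
  define c where "c i j = (case A $ i $ j of None \<Rightarrow> 1 | Some s \<Rightarrow> pm_val s)" for i j
  define u where "u i = (\<lambda>k. if k < CARD('n) then c i (inv e k) else 0)" for i
  have eN: "e j < CARD('n)" for j
    using e by (auto simp: bij_betw_def)
  have ie: "inv e (e j) = j" for j
    using e by (simp add: bij_betw_def)
  have c0: "c i j \<noteq> 0" for i j
    by (auto simp: c_def split: option.split) (metis pm.exhaust pm_val.simps zero_neq_one neg_equal_0_iff_equal)
  have "u i \<noteq> (\<lambda>_. 0)" for i
    using c0 eN ie by (auto simp: u_def fun_eq_iff)
  moreover have "v j \<noteq> (\<lambda>_. 0)" for j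
    by (auto simp: v_def fun_eq_iff)
  moreover have "(\<Sum>k<CARD('n). u i k * v j k) = c i j" for i j
    using eN [of j] by (simp add: u_def v_def ie if_distrib cong: if_cong)
  moreover have "sgn (pm_val s) = pm_val s" for s
    by (cases s) auto
  ultimately have "sign_realizable A CARD('n)"
    unfolding sign_realizable_def
    by (intro exI [of _ u] exI [of _ v])
       (use eN in \<open>auto simp: topspace_Euclidean_space u_def v_def c_def not_less [symmetric]\<close>)
  then show ?thesis ..
qed

lemma equivariant_to_sphere_exists:
  fixes A :: "('m::finite, 'n::finite) psign_matrix"
  shows "\<exists>d f. equivariant_to_sphere (top_of_set (realization (sign_complex A))) uminus d f"
proof -
  obtain e :: "nat \<Rightarrow> 'n" where e: "bij_betw e {0..<CARD('n)} UNIV"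
    using ex_bij_betw_nat_finite [of "UNIV :: 'n set"] by auto
  let ?R = "realization (sign_complex A)"
  have N: "Suc (CARD('n) - 1) = CARD('n)"
    by simp
  define f where "f x = (\<lambda>k. if k < CARD('n) then x $ e k / norm x else 0)" for x :: "real^'n"
  have nz: "norm x \<noteq> 0" if "x \<in> ?R" for x
    using zero_notin_realization that by force
  have "continuous_map (top_of_set ?R) (Euclidean_space CARD('n)) f"
    unfolding f_def
  proof (subst continuous_map_componentwise_Euclidean_space, intro allI impI)
    fix k
    show "continuous_map (top_of_set ?R) euclideanreal (\<lambda>x. x $ e k / norm x)"
      using nz by (auto intro!: continuous_intros)
  qed
  moreover have "(\<Sum>k\<le>CARD('n) - 1. (f x k)\<^sup>2) = 1" if "x \<in> ?R" for x
  proof -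
    have "(\<Sum>k\<le>CARD('n) - 1. (f x k)\<^sup>2) = (\<Sum>k\<in>{0..<CARD('n)}. (x $ e k / norm x)\<^sup>2)"
      by (rule sum.cong) (auto simp: f_def, use N in linarith)
    also have "\<dots> = (\<Sum>j\<in>UNIV. (x $ j / norm x)\<^sup>2)"
      by (rule sum.reindex_bij_betw [OF e])
    also have "\<dots> = (\<Sum>j\<in>UNIV. (x $ j)\<^sup>2) / (norm x)\<^sup>2"
      by (simp add: power_divide sum_divide_distrib)
    also have "\<dots> = 1"
      using nz [OF that] by (simp add: norm_vec_def L2_set_def sum_nonneg)
    finally show ?thesis .
  qed
  ultimately have "continuous_map (top_of_set ?R) (nsphere (CARD('n) - 1)) f"
    by (auto simp: nsphere_def continuous_map_in_subtopology)
  moreover have "f (- x) = (\<lambda>k. - f x k)" for x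
    by (auto simp: f_def)
  ultimately show ?thesis
    unfolding equivariant_to_sphere_def by blast
qed

end

theory Submission
  imports Defs
begin

text \<open>
  A realization of \<open>A\<close> in dimension \<open>d\<close> by row vectors \<open>u\<^sub>i\<close> and column vectors \<open>v\<^sub>j\<close> yields
  the linear, hence odd, map \<open>g x = \<Sum>j. x\<^sub>j v\<^sub>j\<close> from \<open>\<real>\<^sup>N\<close> to \<open>\<real>\<^sup>d\<close>, which sends \<open>j\<^sup>+\<close> and \<open>j\<^sup>-\<close>
  to \<open>v\<^sub>j\<close> and \<open>- v\<^sub>j\<close>. On the simplex \<open>\<sigma>\<^sub>i\<^sup>+\<close> of row \<open>i\<close> the functional \<open>\<langle>u\<^sub>i, g x\<rangle>\<close> is positive at
  every vertex, because the sign carried by each vertex is the sign of \<open>\<langle>u\<^sub>i, v\<^sub>j\<rangle>\<close>; hence it is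
  positive on the whole simplex. On \<open>\<sigma>\<^sub>i\<^sup>-\<close> it is negative. So \<open>g\<close> has no zero on the realization of
  the sign complex (\<open>sign_pattern_inner_nonzero\<close>), and \<open>g x / \<parallel>g x\<parallel>\<close> is an
  equivariant map to the sphere of dimension \<open>d - 1\<close> (\<open>equivariant_to_sphere_normalize\<close>).
\<close>

text \<open>The hypothesis only determines the signs of the entries of \<open>b i\<close> at the columns where row
  \<open>i\<close> is specified, and this suffices since each simplex of row \<open>i\<close> is supported there.
  The set where \<open>b i\<close> is positive is a convex halfspace, so it contains a simplex as
  soon as it contains its vertices.\<close>

lemma sign_pattern_inner_nonzero:
  fixes A :: "('m::finite, 'n::finite) psign_matrix" and b :: "'m \<Rightarrow> real^'n"
  assumes sgn_b: "\<And>i j s. A $ i $ j = Some s \<Longrightarrow> sgn (b i $ j) = pm_val s"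
    and x: "x \<in> realization (sign_complex A)"
  shows "\<exists>i. b i \<bullet> x \<noteq> 0"
proof -
  obtain \<tau> i where x_hull: "x \<in> convex hull (vertex_point ` \<tau>)"
    and \<tau>: "\<tau> \<subseteq> sigma_pos (A $ i) \<or> \<tau> \<subseteq> sigma_neg (A $ i)"
    using x by (auto simp: realization_def sign_complex_def)
  have inner_vertex: "b i \<bullet> vertex_point (j, s) = pm_val s * b i $ j" for j s
    by (simp add: vertex_point_def inner_axis)
  have pos: "b i \<bullet> vertex_point (j, s) > 0" if "A $ i $ j = Some s" for j s
    using sgn_b [OF that] by (cases s) (auto simp: inner_vertex sgn_if split: if_splits)
  have neg: "b i \<bullet> vertex_point (j, s) < 0" if "A $ i $ j = Some (opp s)" for j s
    using sgn_b [OF that] by (cases s) (auto simp: inner_vertex sgn_if split: if_splits)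
  from \<tau> show ?thesis
  proof
    assume "\<tau> \<subseteq> sigma_pos (A $ i)"
    then have "vertex_point ` \<tau> \<subseteq> {y. b i \<bullet> y > 0}"
      by (auto dest!: subsetD simp: mem_sigma_pos intro!: pos)
    then have "convex hull (vertex_point ` \<tau>) \<subseteq> {y. b i \<bullet> y > 0}"
      by (rule hull_minimal) (rule convex_halfspace_gt)
    with x_hull have "b i \<bullet> x > 0"
      by auto
    then show ?thesis
      by (intro exI [of _ i]) simp
  next
    assume "\<tau> \<subseteq> sigma_neg (A $ i)"
    then have "vertex_point ` \<tau> \<subseteq> {y. b i \<bullet> y < 0}"
      by (auto dest!: subsetD simp: mem_sigma_neg intro!: neg)
    then have "convex hull (vertex_point ` \<tau>) \<subseteq> {y. b i \<bullet> y < 0}"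
      by (rule hull_minimal) (rule convex_halfspace_lt)
    with x_hull have "b i \<bullet> x < 0"
      by auto
    then show ?thesis
      by (intro exI [of _ i]) simp
  qed
qed

lemma equivariant_to_sphere_normalize:
  assumes cont: "continuous_map X (Euclidean_space (Suc d)) g"
    and nonzero: "\<And>x. x \<in> topspace X \<Longrightarrow> g x \<noteq> (\<lambda>_. 0)"
    and odd: "\<And>x. x \<in> topspace X \<Longrightarrow> g (\<nu> x) = (\<lambda>k. - g x k)"
  shows "equivariant_to_sphere X \<nu> d (\<lambda>x k. g x k / sqrt (\<Sum>l\<le>d. (g x l)\<^sup>2))"
proof -
  let ?r = "\<lambda>x. sqrt (\<Sum>l\<le>d. (g x l)\<^sup>2)"
  have supp: "g x k = 0" if "x \<in> topspace X" "d < k" for x k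
    using continuous_map_image_subset_topspace [OF cont] that
    by (auto simp: topspace_Euclidean_space)
  have r_pos: "?r x > 0" if x: "x \<in> topspace X" for x
  proof -
    obtain k where k: "g x k \<noteq> 0"
      using nonzero [OF x] by auto
    then have "k \<le> d"
      using supp [OF x] by (meson not_le)
    with k have "(\<Sum>l\<le>d. (g x l)\<^sup>2) > 0"
      by (intro sum_pos2 [of _ k]) auto
    then show ?thesis by simp
  qed
  have comp: "continuous_map X euclideanreal (\<lambda>x. g x k)" for k
    using cont unfolding Euclidean_space_def
    by (auto simp: continuous_map_in_subtopology continuous_map_componentwise_UNIV)
  have "continuous_map X (Euclidean_space (Suc d)) (\<lambda>x k. g x k / ?r x)"
    unfolding Euclidean_space_def continuous_map_in_subtopology continuous_map_componentwise_UNIV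
  proof (intro conjI allI)
    show "continuous_map X euclideanreal (\<lambda>x. g x k / ?r x)" for k
      using r_pos
      by (intro continuous_map_real_divide continuous_map_sqrt continuous_map_sum
            continuous_map_real_pow comp) force+
  qed (auto simp: supp)
  moreover have "(\<Sum>k\<le>d. (g x k / ?r x)\<^sup>2) = 1" if "x \<in> topspace X" for x
  proof -
    have "(\<Sum>k\<le>d. (g x k / ?r x)\<^sup>2) = (\<Sum>k\<le>d. (g x k)\<^sup>2) / (?r x)\<^sup>2"
      by (simp add: power_divide sum_divide_distrib)
    also have "\<dots> = 1"
      using r_pos [OF that] by (simp add: sum_nonneg)
    finally show ?thesis .
  qed
  ultimately show ?thesis
    by (auto simp: equivariant_to_sphere_def nsphere_def continuous_map_in_subtopology odd)
qed

text \<open>There are rows because index types are nonempty, and \<open>\<real>\<^sup>0\<close> has no nonzero vector to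
  assign to them.\<close>

lemma sign_realizable_pos:
  assumes "sign_realizable A d"
  shows "d > 0"
proof (rule ccontr)
  assume "\<not> d > 0"
  with assms show False
    by (auto simp: sign_realizable_def topspace_Euclidean_space fun_eq_iff)
qed

lemma equivariant_to_sphere_if_sign_realizable:
  fixes A :: "('m::finite, 'n::finite) psign_matrix"
  assumes "sign_realizable A (Suc d)"
  shows "\<exists>f. equivariant_to_sphere (top_of_set (realization (sign_complex A))) uminus d f"
proof -
  let ?R = "realization (sign_complex A)"
  obtain u :: "'m \<Rightarrow> nat \<Rightarrow> real" and v :: "'n \<Rightarrow> nat \<Rightarrow> real"
    where v: "\<And>j. v j \<in> topspace (Euclidean_space (Suc d))"
      and uv: "\<And>i j s. A $ i $ j = Some s \<Longrightarrow> sgn (\<Sum>k<Suc d. u i k * v j k) = pm_val s"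
    using assms unfolding sign_realizable_def by blast
  define g where "g x k = (\<Sum>j\<in>UNIV. x $ j * v j k)" for x :: "real^'n" and k
  define b where "b i = (\<chi> j. \<Sum>k<Suc d. u i k * v j k)" for i
  \<comment> \<open>The inner product of \<open>u\<^sub>i\<close> with \<open>g x\<close>, as a functional of \<open>x\<close>.\<close>
  have b_g: "b i \<bullet> x = (\<Sum>k<Suc d. u i k * g x k)" for i x
  proof -
    have "b i \<bullet> x = (\<Sum>j\<in>UNIV. \<Sum>k<Suc d. u i k * (x $ j * v j k))"
      unfolding b_def inner_vec_def
      by (simp only: vec_lambda_beta inner_real_def sum_distrib_left sum_distrib_right mult_ac)
    also have "\<dots> = (\<Sum>k<Suc d. u i k * g x k)"
      unfolding g_def sum_distrib_left by (rule sum.swap)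
    finally show ?thesis .
  qed
  have "g x \<noteq> (\<lambda>_. 0)" if "x \<in> ?R" for x
  proof
    assume "g x = (\<lambda>_. 0)"
    then have "b i \<bullet> x = 0" for i
      by (simp add: b_g)
    moreover have "\<exists>i. b i \<bullet> x \<noteq> 0"
      using that by (intro sign_pattern_inner_nonzero) (simp_all only: b_def vec_lambda_beta uv)
    ultimately show False by blast
  qed
  moreover have "continuous_map (top_of_set ?R) (Euclidean_space (Suc d)) g"
    unfolding Euclidean_space_def continuous_map_in_subtopology continuous_map_componentwise_UNIV
  proof (intro conjI allI)
    show "continuous_map (top_of_set ?R) euclideanreal (\<lambda>x. g x k)" for k
      unfolding g_def by (auto intro!: continuous_intros)
  qed (use v in \<open>auto simp: g_def topspace_Euclidean_space\<close>)
  moreover have "g (- x) = (\<lambda>k. - g x k)" for x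
    by (simp add: g_def fun_eq_iff sum_negf)
  ultimately show ?thesis
    using equivariant_to_sphere_normalize [of "top_of_set ?R" d g uminus] by auto
qed

theorem corollary2:
  fixes A :: "('m::finite, 'n::finite) psign_matrix"
  shows "int (complex_index (sign_complex A)) \<le> int (sign_rank A) - 1"
proof -
  have real: "sign_realizable A (sign_rank A)"
    unfolding sign_rank_def using sign_realizable_exists by (rule LeastI_ex)
  then obtain d where d: "sign_rank A = Suc d"
    using sign_realizable_pos gr0_conv_Suc by blast
  have "complex_index (sign_complex A) \<le> d"
    unfolding complex_index_def Z2_index_def
    using equivariant_to_sphere_if_sign_realizable [OF real [unfolded d]] by (rule Least_le)
  with d show ?thesis by simp
qed

end
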